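(* Let $(X,d)$ be a finite metric space with canonical graph $G=(X,E)$ (each edge $uv\in E$ having weight $d(u,v)$), let $f\in \mathrm{TP}(X)$ be a transportation problem, and let $p$ be a roadmap for $f$. Then $p$ is not optimal if and only if the graph $G$ contains a directed cycle $c$ (a cycle of $G$ with one of its two cyclic directions) such that the total weight of those edges of $c$ which are in $\operatorname{supp} p$ and whose direction induced by $p$ is opposite to their direction in $c$ exceeds the total weight of all other edges of $c$.
   Context: Let $(X,d)$ be a finite metric space. $\mathrm{TP}(X)$ is the real vector space of functions $f:X\to\mathbb{R}$ with $\sum_{v\in X} f(v)=0$ (transportation problems). Canonical graph: take the complete graph on $X$ with edge $uv$ weighted by $d(u,v)$, and delete every edge $uv$ for which there is $w\notin\{u,v\}$ with $d(u,w)+d(w,v)=d(u,v)$. The result is the canonical graph $G=(X,E)$; its weighted graph distance equals $d$. Cycles are in the usual graph-theoretic sense in the undirected graph $G$ (no repeated vertices, length at least 3). Fix an arbitrary reference orientation of $E$, so each edge $e$ has a tail and a head. A roadmap is a function $p:E\to\mathbb{R}$; its cost is $\|p\|_{1,d}=\sum_{uv\in E}|p(uv)|\,d(u,v)$. It is a roadmap for $f\in\mathrm{TP}(X)$ if for all $v\in X$ $$f(v)=\sum_{\mathrm{tail}(e)=v}p(e)-\sum_{\mathrm{head}(e)=v}p(e).$$ A roadmap $p$ for $f$ is optimal if it has the minimal cost among all roadmaps for $f$. Set $\operatorname{supp}p=\{e\in E: p(e)\neq0\}$. For $e\in\operatorname{supp}p$, the direction of $e$ induced by $p$ is the reference orientation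 if $p(e)>0$ and the opposite one if $p(e)<0$. *)

theory Defs
  imports "HOL-Analysis.Abstract_Metric_Spaces"
begin

text \<open>
  A metric space is a set \<open>X\<close> with a function \<open>d\<close> satisfying the library predicate
  \<^const>\<open>Metric_space\<close>.  Undirected edges are two-element sets of vertices.  Functions on \<open>X\<close> or
  on the edge set \<open>E\<close> are total functions of which only the values on \<open>X\<close> or \<open>E\<close> are ever used.
\<close>

definition TP :: "'a set \<Rightarrow> ('a \<Rightarrow> real) set" where
  "TP X = {f. (\<Sum>v\<in>X. f v) = 0}"

definition canonical_edges :: "'a set \<Rightarrow> ('a \<Rightarrow> 'a \<Rightarrow> real) \<Rightarrow> 'a set set" where
  "canonical_edges X d =
     {{u, v} | u v. u \<in> X \<and> v \<in> X \<and> u \<noteq> v \<and>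
                    \<not> (\<exists>w\<in>X - {u, v}. d u w + d w v = d u v)}"

definition orientation :: "'a set set \<Rightarrow> ('a set \<Rightarrow> 'a) \<Rightarrow> ('a set \<Rightarrow> 'a) \<Rightarrow> bool" where
  "orientation E tail head \<longleftrightarrow> (\<forall>e\<in>E. e = {tail e, head e})"

text \<open>
  The weight of an edge \<open>e = uv\<close> is \<open>d u v\<close>; by symmetry of \<open>d\<close> it may be read off from the
  endpoints in the order given by the orientation.
\<close>

definition roadmap_cost ::
  "'a set set \<Rightarrow> ('a set \<Rightarrow> 'a) \<Rightarrow> ('a set \<Rightarrow> 'a) \<Rightarrow> ('a \<Rightarrow> 'a \<Rightarrow> real) \<Rightarrow> ('a set \<Rightarrow> real) \<Rightarrow> real" where
  "roadmap_cost E tail head d p = (\<Sum>e\<in>E. \<bar>p e\<bar> * d (tail e) (head e))"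

definition roadmap_for ::
  "'a set \<Rightarrow> 'a set set \<Rightarrow> ('a set \<Rightarrow> 'a) \<Rightarrow> ('a set \<Rightarrow> 'a) \<Rightarrow> ('a \<Rightarrow> real) \<Rightarrow> ('a set \<Rightarrow> real) \<Rightarrow> bool" where
  "roadmap_for X E tail head f p \<longleftrightarrow>
     (\<forall>v\<in>X. f v = (\<Sum>e\<in>{e\<in>E. tail e = v}. p e) - (\<Sum>e\<in>{e\<in>E. head e = v}. p e))"

definition optimal_roadmap_for ::
  "'a set \<Rightarrow> 'a set set \<Rightarrow> ('a set \<Rightarrow> 'a) \<Rightarrow> ('a set \<Rightarrow> 'a) \<Rightarrow> ('a \<Rightarrow> 'a \<Rightarrow> real) \<Rightarrow>
   ('a \<Rightarrow> real) \<Rightarrow> ('a set \<Rightarrow> real) \<Rightarrow> bool" where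
  "optimal_roadmap_for X E tail head d f p \<longleftrightarrow>
     roadmap_for X E tail head f p \<and>
     (\<forall>q. roadmap_for X E tail head f q \<longrightarrow>
          roadmap_cost E tail head d p \<le> roadmap_cost E tail head d q)"

definition supp :: "'a set set \<Rightarrow> ('a set \<Rightarrow> real) \<Rightarrow> 'a set set" where
  "supp E p = {e\<in>E. p e \<noteq> 0}"

text \<open>Only meaningful for edges in the support of \<open>p\<close>.\<close>

definition induced_direction ::
  "('a set \<Rightarrow> 'a) \<Rightarrow> ('a set \<Rightarrow> 'a) \<Rightarrow> ('a set \<Rightarrow> real) \<Rightarrow> 'a set \<Rightarrow> 'a \<times> 'a" where
  "induced_direction tail head p e = (if p e > 0 then (tail e, head e) else (head e, tail e))"

text \<open>
  A directed cycle is given by the list of its vertices in cyclic order; the last vertex is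
  joined to the first one, and reversing the list gives the other cyclic direction.
\<close>

definition cycle_arcs :: "'a list \<Rightarrow> ('a \<times> 'a) set" where
  "cycle_arcs c = set (zip c (rotate1 c))"

definition directed_cycle :: "'a set set \<Rightarrow> 'a list \<Rightarrow> bool" where
  "directed_cycle E c \<longleftrightarrow>
     distinct c \<and> length c \<ge> 3 \<and> (\<forall>(u, v)\<in>cycle_arcs c. {u, v} \<in> E)"

definition opposed_arcs ::
  "'a set set \<Rightarrow> ('a set \<Rightarrow> 'a) \<Rightarrow> ('a set \<Rightarrow> 'a) \<Rightarrow> ('a set \<Rightarrow> real) \<Rightarrow> 'a list \<Rightarrow> ('a \<times> 'a) set" where
  "opposed_arcs E tail head p c =
     {(u, v)\<in>cycle_arcs c. {u, v} \<in> supp E p \<and> induced_direction tail head p {u, v} = (v, u)}"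

end

theory Submission
  imports Defs
begin

text \<open>
  Give each arc \<open>(u, v)\<close> the rate at which the cost of \<open>p\<close> changes when a little more is sent from
  \<open>u\<close> to \<open>v\<close>: this is \<open>- d u v\<close> if \<open>p\<close> uses the edge in the opposite direction, so that the new
  traffic cancels old traffic, and \<open>d u v\<close> otherwise.  The cycle condition of the theorem says
  exactly that some directed cycle has negative total rate.

  Given such a cycle, send an amount \<open>t\<close> around it, where \<open>t\<close> is the least load of \<open>p\<close> on the
  opposed edges.  This leaves the problem solved by the roadmap unchanged, and since no load
  is reversed, the cost changes by at most \<open>t\<close> times the rate of the cycle; hence \<open>p\<close> was not
  optimal.

  Conversely, let \<open>q\<close> be a cheaper roadmap for the same problem, and direct each edge on which
  \<open>q - p\<close> does not vanish according to the sign of \<open>q - p\<close>.  By the convexity of the absolute value,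
  the cost of \<open>q\<close> exceeds that of \<open>p\<close> by at least the rates of these arcs weighted by
  \<open>\<bar>q - p\<bar>\<close>, so this weighted sum is negative.  But \<open>q - p\<close> is a circulation, and a positive
  circulation is a positive combination of directed cycles contained in its support
  (\<open>circulation_weight_nonneg\<close>).  So one of these cycles has negative rate.
\<close>

section \<open>Cycles and circulations in finite digraphs\<close>

lemma finite_cycle_arcs: "finite (cycle_arcs c)"
  by (simp add: cycle_arcs_def)

text \<open>
  The arcs of a cycle start in its vertices, and they end in the same vertices taken in the rotated
  order, so a cycle leaves every vertex as often as it enters it.
\<close>

lemma cycle_arcs_balanced:
  assumes "distinct c"
  shows "(\<Sum>a\<in>cycle_arcs c. of_bool (fst a = v) - of_bool (snd a = v) :: real) = 0"
proof -
  let ?zs = "zip c (rotate1 c)"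
  let ?b = "\<lambda>x. of_bool (x = v) :: real"
  have dist: "distinct ?zs" using assms by (simp add: distinct_zipI1)
  have "(\<Sum>a\<in>cycle_arcs c. ?b (fst a)) = sum_list (map ?b (map fst ?zs))"
    unfolding cycle_arcs_def using dist
    by (simp add: sum_list_distinct_conv_sum_set comp_def del: map_fst_zip)
  also have "\<dots> = sum_list (map ?b c)" by simp
  also have "\<dots> = sum_list (map ?b (rotate1 c))"
    by (cases c) simp_all
  also have "\<dots> = sum_list (map ?b (map snd ?zs))" by simp
  also have "\<dots> = (\<Sum>a\<in>cycle_arcs c. ?b (snd a))"
    unfolding cycle_arcs_def using dist
    by (simp add: sum_list_distinct_conv_sum_set comp_def del: map_snd_zip)
  finally show ?thesis by (simp add: sum_subtractf)
qed

text \<open>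
  A walk that never gets stuck must revisit a vertex; up to its first repetition it has run through
  a cycle, possibly after an initial tail.
\<close>

lemma cycle_exists:
  assumes "finite D" "D \<noteq> {}" and next_arc: "\<And>u v. (u, v) \<in> D \<Longrightarrow> \<exists>w. (v, w) \<in> D"
  obtains c where "c \<noteq> []" "distinct c" "cycle_arcs c \<subseteq> D"
proof -
  define s where "s v = (SOME w. (v, w) \<in> D)" for v
  have s: "(v, s v) \<in> D" if "v \<in> snd ` D" for v
  proof -
    from that next_arc have "\<exists>w. (v, w) \<in> D" by auto
    then show ?thesis unfolding s_def by (rule someI_ex)
  qed
  from \<open>D \<noteq> {}\<close> obtain x where x: "x \<in> snd ` D" by blast
  define g where "g k = (s ^^ k) x" for k
  have gS: "g k \<in> snd ` D" for k
  proof (induction k)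
    case 0 then show ?case using x by (simp add: g_def)
  next
    case (Suc k) from s[OF this] show ?case by (force simp: g_def)
  qed
  have gD: "(g k, g (Suc k)) \<in> D" for k using s[OF gS[of k]] by (simp add: g_def)
  have "\<not> inj g"
  proof
    assume "inj g"
    then have "infinite (range g)" using finite_imageD infinite_UNIV_nat by blast
    moreover have "finite (range g)"
      using gS \<open>finite D\<close> by (meson finite_imageI finite_subset image_subsetI)
    ultimately show False by blast
  qed
  then have "\<exists>j i. i < j \<and> g i = g j"
    unfolding inj_def by (metis linorder_neqE_nat)
  then have ex: "\<exists>j. \<exists>i<j. g i = g j" by blast
  define j where "j = (LEAST j. \<exists>i<j. g i = g j)"
  from LeastI_ex[OF ex] obtain i where ij: "i < j" "g i = g j" unfolding j_def by blast
  have first: "\<not> (\<exists>i<k. g i = g k)" if "k < j" for k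
    using not_less_Least that unfolding j_def by blast
  define c where "c = map g [i..<j]"
  have "inj_on g {i..<j}"
    unfolding inj_on_def by (metis first atLeastLessThan_iff linorder_neqE_nat)
  then have "distinct c" by (simp add: c_def distinct_map)
  moreover have "c \<noteq> []" using ij by (simp add: c_def)
  moreover have "cycle_arcs c \<subseteq> D"
  proof
    fix a assume "a \<in> cycle_arcs c"
    then obtain k where k: "k < j - i" "a = (c ! k, rotate1 c ! k)"
      by (auto simp: cycle_arcs_def set_zip c_def)
    then have "rotate1 c ! k = c ! (Suc k mod (j - i))"
      using nth_rotate1[of k c] by (simp add: c_def)
    also have "\<dots> = g (Suc (i + k))"
    proof (cases "Suc k = j - i")
      case True
      then have "Suc (i + k) = j" by simp
      then show ?thesis using True ij by (simp add: c_def)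
    next
      case False
      then show ?thesis using k by (simp add: c_def)
    qed
    finally show "a \<in> D" using k gD[of "i + k"] by (simp add: c_def)
  qed
  ultimately show thesis using that by blast
qed

text \<open>
  Conformal decomposition of a circulation, in the form of its effect on arc weights.  A nonempty
  support contains a cycle; subtracting the least value of \<open>F\<close> on this cycle keeps \<open>F\<close> a circulation
  and removes at least one arc from the support, so induction on the size of the support applies.
\<close>

lemma circulation_weight_nonneg:
  fixes F w :: "'a \<times> 'a \<Rightarrow> real"
  assumes "finite D"
    and "\<And>a. a \<in> D \<Longrightarrow> F a > 0"
    and "\<And>v. (\<Sum>a\<in>D. F a * (of_bool (fst a = v) - of_bool (snd a = v))) = 0"
    and "\<And>c. \<lbrakk>c \<noteq> []; distinct c; cycle_arcs c \<subseteq> D\<rbrakk> \<Longrightarrow> (\<Sum>a\<in>cycle_arcs c. w a) \<ge> 0"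
  shows "(\<Sum>a\<in>D. F a * w a) \<ge> 0"
  using assms
proof (induction D arbitrary: F rule: finite_psubset_induct)
  case (psubset D F)
  show ?case
  proof (cases "D = {}")
    case False
    \<comment> \<open>A vertex with inflow but no outflow would violate conservation.\<close>
    have next_arc: "\<exists>w. (v, w) \<in> D" if uv: "(u, v) \<in> D" for u v
    proof (rule ccontr)
      assume "\<not> ?thesis"
      then have "(\<Sum>a\<in>D. F a * (of_bool (fst a = v) - of_bool (snd a = v)))
               = (\<Sum>a\<in>D. - (F a * of_bool (snd a = v)))"
        by (intro sum.cong) auto
      then have "(\<Sum>a\<in>D. F a * of_bool (snd a = v)) = 0"
        using psubset.prems(2)[of v] by (simp add: sum_negf)
      moreover have "F (u, v) * of_bool (snd (u, v) = v) \<le> (\<Sum>a\<in>D. F a * of_bool (snd a = v))"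
        using psubset.prems(1) uv psubset.hyps by (intro member_le_sum) (auto intro: less_imp_le)
      ultimately show False using psubset.prems(1)[OF uv] by simp
    qed
    obtain c where c: "c \<noteq> []" "distinct c" "cycle_arcs c \<subseteq> D"
      using psubset.hyps False next_arc by (rule cycle_exists)
    let ?C = "cycle_arcs c"
    define m where "m = Min (F ` ?C)"
    have neC: "?C \<noteq> {}" using c(1) by (cases c) (auto simp: cycle_arcs_def)
    have "m \<in> F ` ?C" unfolding m_def using neC finite_cycle_arcs by (intro Min_in) auto
    then obtain b where b: "b \<in> ?C" "F b = m" by auto
    have mle: "m \<le> F a" if "a \<in> ?C" for a
      unfolding m_def using that finite_cycle_arcs by (intro Min_le) auto
    have "m > 0" using psubset.prems(1)[of b] b c(3) by blast
    define F' where "F' a = F a - m * of_bool (a \<in> ?C)" for a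
    define D' where "D' = {a \<in> D. F' a > 0}"
    have F'0: "F' a \<ge> 0" if "a \<in> D" for a
      using mle[of a] psubset.prems(1)[OF that] by (auto simp: F'_def)
    have "b \<in> D" "b \<notin> D'" using b c(3) by (auto simp: D'_def F'_def)
    then have sub: "D' \<subset> D" by (auto simp: D'_def)
    have split: "(\<Sum>a\<in>D. F a * h a) = (\<Sum>a\<in>D'. F' a * h a) + m * (\<Sum>a\<in>?C. h a)" for h
    proof -
      have "(\<Sum>a\<in>D. F a * h a) = (\<Sum>a\<in>D. F' a * h a + m * (if a \<in> ?C then h a else 0))"
        by (intro sum.cong) (auto simp: F'_def algebra_simps)
      also have "\<dots> = (\<Sum>a\<in>D. F' a * h a) + m * (\<Sum>a\<in>D. if a \<in> ?C then h a else 0)"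
        by (simp add: sum.distrib sum_distrib_left)
      also have "(\<Sum>a\<in>D. if a \<in> ?C then h a else 0) = (\<Sum>a\<in>?C. h a)"
        using c(3) psubset.hyps by (simp add: sum.If_cases Int_absorb1)
      also have "(\<Sum>a\<in>D. F' a * h a) = (\<Sum>a\<in>D'. F' a * h a)"
        using psubset.hyps F'0 by (intro sum.mono_neutral_right) (force simp: D'_def)+
      finally show ?thesis .
    qed
    have "(\<Sum>a\<in>D'. F' a * w a) \<ge> 0"
    proof (rule psubset.IH[OF sub])
      show "(\<Sum>a\<in>D'. F' a * (of_bool (fst a = v) - of_bool (snd a = v))) = 0" for v
        using split[of "\<lambda>a. of_bool (fst a = v) - of_bool (snd a = v)"] psubset.prems(2)[of v]
          cycle_arcs_balanced[OF c(2), of v] by simp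
    qed (use sub psubset.prems(3) in \<open>auto simp: D'_def\<close>)
    moreover have "(\<Sum>a\<in>?C. w a) \<ge> 0" using c psubset.prems(3) by blast
    ultimately show ?thesis unfolding split using \<open>m > 0\<close> by simp
  qed simp
qed

section \<open>Rates of cost change along arcs\<close>

definition opposed ::
  "'a set set \<Rightarrow> ('a set \<Rightarrow> 'a) \<Rightarrow> ('a set \<Rightarrow> 'a) \<Rightarrow> ('a set \<Rightarrow> real) \<Rightarrow> 'a \<times> 'a \<Rightarrow> bool" where
  "opposed E tail head p = (\<lambda>(u, v).
     {u, v} \<in> supp E p \<and> induced_direction tail head p {u, v} = (v, u))"

definition cost_rate ::
  "'a set set \<Rightarrow> ('a set \<Rightarrow> 'a) \<Rightarrow> ('a set \<Rightarrow> 'a) \<Rightarrow> ('a \<Rightarrow> 'a \<Rightarrow> real) \<Rightarrow> ('a set \<Rightarrow> real) \<Rightarrow>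
   'a \<times> 'a \<Rightarrow> real" where
  "cost_rate E tail head d p = (\<lambda>(u, v). if opposed E tail head p (u, v) then - d u v else d u v)"

lemma sum_cost_rate_cycle:
  "(\<Sum>a\<in>cycle_arcs c. cost_rate E tail head d p a) =
     (\<Sum>(u, v)\<in>cycle_arcs c - opposed_arcs E tail head p c. d u v)
     - (\<Sum>(u, v)\<in>opposed_arcs E tail head p c. d u v)"
proof -
  let ?O = "opposed_arcs E tail head p c"
  have O: "?O = {a \<in> cycle_arcs c. opposed E tail head p a}"
    by (auto simp: opposed_arcs_def opposed_def)
  have "(\<Sum>a\<in>cycle_arcs c. cost_rate E tail head d p a) =
        (\<Sum>a\<in>cycle_arcs c - ?O. cost_rate E tail head d p a) + (\<Sum>a\<in>?O. cost_rate E tail head d p a)"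
    by (rule sum.subset_diff) (auto simp: O finite_cycle_arcs)
  also have "(\<Sum>a\<in>cycle_arcs c - ?O. cost_rate E tail head d p a) =
             (\<Sum>(u, v)\<in>cycle_arcs c - ?O. d u v)"
    by (intro sum.cong) (auto simp: O cost_rate_def)
  also have "(\<Sum>a\<in>?O. cost_rate E tail head d p a) = (\<Sum>(u, v)\<in>?O. - d u v)"
    by (intro sum.cong) (auto simp: O cost_rate_def)
  also have "\<dots> = - (\<Sum>(u, v)\<in>?O. d u v)"
    by (simp add: sum_negf case_prod_unfold)
  finally show ?thesis by simp
qed

section \<open>Roadmaps on finite graphs\<close>

context
  fixes X :: "'a set" and E :: "'a set set" and tail head :: "'a set \<Rightarrow> 'a"
    and d :: "'a \<Rightarrow> 'a \<Rightarrow> real"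
  assumes finite_E: "finite E"
    and edge_ends: "\<And>e. e \<in> E \<Longrightarrow> {tail e, head e} = e"
    and no_loop: "\<And>e. e \<in> E \<Longrightarrow> tail e \<noteq> head e"
    and edges_in: "\<And>e. e \<in> E \<Longrightarrow> e \<subseteq> X"
    and d_nonneg: "\<And>u v. d u v \<ge> 0"
    and d_sym: "\<And>u v. d u v = d v u"
begin

lemma edge_ends': "e \<in> E \<Longrightarrow> {head e, tail e} = e"
  using edge_ends by (metis insert_commute)

lemma roadmap_for_iff:
  "roadmap_for X E tail head f p \<longleftrightarrow>
     (\<forall>v\<in>X. f v = (\<Sum>e\<in>E. p e * (of_bool (tail e = v) - of_bool (head e = v))))"
proof -
  have restrict: "(\<Sum>e\<in>{e\<in>E. P e}. p e) = (\<Sum>e\<in>E. p e * of_bool (P e))" for P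
  proof -
    have "(\<Sum>e\<in>{e\<in>E. P e}. p e) = (\<Sum>e\<in>E. if P e then p e else 0)"
      using finite_E by (simp add: sum.inter_filter)
    also have "\<dots> = (\<Sum>e\<in>E. p e * of_bool (P e))" by (intro sum.cong) auto
    finally show ?thesis .
  qed
  show ?thesis
    unfolding roadmap_for_def restrict by (simp add: sum_subtractf right_diff_distrib)
qed

lemma opposed_forward: "e \<in> E \<Longrightarrow> opposed E tail head p (tail e, head e) \<longleftrightarrow> p e < 0"
  using no_loop[of e] by (auto simp: opposed_def edge_ends supp_def induced_direction_def)

lemma opposed_backward: "e \<in> E \<Longrightarrow> opposed E tail head p (head e, tail e) \<longleftrightarrow> p e > 0"
  using no_loop[of e] by (auto simp: opposed_def edge_ends' supp_def induced_direction_def)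

lemma cost_rate_forward:
  "e \<in> E \<Longrightarrow> cost_rate E tail head d p (tail e, head e) =
     (if p e < 0 then - d (tail e) (head e) else d (tail e) (head e))"
  by (simp add: cost_rate_def opposed_forward)

lemma cost_rate_backward:
  "e \<in> E \<Longrightarrow> cost_rate E tail head d p (head e, tail e) =
     (if p e > 0 then - d (tail e) (head e) else d (tail e) (head e))"
  using d_sym[of "tail e" "head e"] by (simp add: cost_rate_def opposed_backward)

text \<open>Each edge carries exactly two arcs, so sums over arcs can be collected edge by edge.\<close>

lemma sum_arcs_by_edges:
  fixes h :: "'a \<times> 'a \<Rightarrow> real"
  assumes "\<And>u v. (u, v) \<in> C \<Longrightarrow> {u, v} \<in> E"
  shows "(\<Sum>a\<in>C. h a) = (\<Sum>e\<in>E. of_bool ((tail e, head e) \<in> C) * h (tail e, head e)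
                              + of_bool ((head e, tail e) \<in> C) * h (head e, tail e))"
proof -
  let ?f = "\<lambda>e. (tail e, head e)" and ?b = "\<lambda>e. (head e, tail e)"
  let ?h = "\<lambda>a. of_bool (a \<in> C) * h a"
  have inj: "inj_on ?f E" "inj_on ?b E"
    by (auto intro!: inj_onI) (metis edge_ends)+
  have disj: "?f ` E \<inter> ?b ` E = {}"
  proof (rule ccontr)
    assume "\<not> ?thesis"
    then obtain e e' where e: "e \<in> E" "e' \<in> E" "?f e = ?b e'" by auto
    then have "e = e'" using edge_ends[OF e(1)] edge_ends'[OF e(2)] by (metis prod.inject)
    then show False using e no_loop by auto
  qed
  have cover: "C \<subseteq> ?f ` E \<union> ?b ` E"
  proof
    fix a assume "a \<in> C"
    obtain u v where a: "a = (u, v)" by (cases a)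
    obtain e where e: "e \<in> E" "e = {u, v}" using assms \<open>a \<in> C\<close> a by blast
    have "{tail e, head e} = {u, v}" using edge_ends[OF e(1)] e(2) by (rule trans)
    then have "(u, v) = ?f e \<or> (u, v) = ?b e" unfolding doubleton_eq_iff by blast
    then show "a \<in> ?f ` E \<union> ?b ` E" using e(1) a by blast
  qed
  have "(\<Sum>a\<in>C. h a) = (\<Sum>a\<in>?f ` E \<union> ?b ` E. ?h a)"
    using cover finite_E by (intro sum.mono_neutral_cong_left) auto
  also have "\<dots> = (\<Sum>a\<in>?f ` E. ?h a) + (\<Sum>a\<in>?b ` E. ?h a)"
    using finite_E disj by (intro sum.union_disjoint) auto
  also have "\<dots> = (\<Sum>e\<in>E. ?h (?f e)) + (\<Sum>e\<in>E. ?h (?b e))"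
    by (simp add: sum.reindex[OF inj(1)] sum.reindex[OF inj(2)])
  finally show ?thesis by (simp add: sum.distrib)
qed

text \<open>
  Rerouting along a cycle of negative rate.  The cycle must contain opposed arcs, since all other
  rates are nonnegative, so the least load on them is a positive amount that can be cancelled.
\<close>

lemma negative_cycle_cheaper_roadmap:
  assumes p: "roadmap_for X E tail head f p"
    and c: "directed_cycle E c"
    and neg: "(\<Sum>a\<in>cycle_arcs c. cost_rate E tail head d p a) < 0"
  shows "\<exists>q. roadmap_for X E tail head f q \<and>
             roadmap_cost E tail head d q < roadmap_cost E tail head d p"
proof -
  let ?C = "cycle_arcs c" and ?w = "cost_rate E tail head d p"
  let ?l = "\<lambda>(u, v). \<bar>p {u, v}\<bar>"
  define T where "T = {a \<in> ?C. opposed E tail head p a}"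
  define t where "t = Min (?l ` T)"
  have finT: "finite T" by (simp add: T_def finite_cycle_arcs)
  have C: "{u, v} \<in> E" if "(u, v) \<in> ?C" for u v using c that by (auto simp: directed_cycle_def)
  have C_sum: "(\<Sum>a\<in>?C. h a) = (\<Sum>e\<in>E. of_bool ((tail e, head e) \<in> ?C) * h (tail e, head e)
                              + of_bool ((head e, tail e) \<in> ?C) * h (head e, tail e))"
    for h :: "'a \<times> 'a \<Rightarrow> real"
    using C by (rule sum_arcs_by_edges)
  have "T \<noteq> {}"
  proof
    assume "T = {}"
    then have "(\<Sum>a\<in>?C. ?w a) \<ge> 0"
      by (intro sum_nonneg) (auto simp: T_def cost_rate_def d_nonneg)
    then show False using neg by simp
  qed
  then have "t \<in> ?l ` T" unfolding t_def using finT by (intro Min_in) auto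
  then have t0: "t > 0" by (auto simp: T_def opposed_def supp_def)
  have tle: "t \<le> \<bar>p {u, v}\<bar>" if "(u, v) \<in> T" for u v
    unfolding t_def using that finT by (intro Min_le) force+
  \<comment> \<open>The two arcs of an edge cancel, so \<open>\<delta>\<close> is the net flow of the cycle even if both belong to it.\<close>
  define \<delta> where "\<delta> e = (of_bool ((tail e, head e) \<in> ?C) - of_bool ((head e, tail e) \<in> ?C) :: real)"
    for e
  define q where "q e = p e + t * \<delta> e" for e
  have bal: "(\<Sum>e\<in>E. \<delta> e * (of_bool (tail e = v) - of_bool (head e = v))) = 0" for v
  proof -
    have "(\<Sum>e\<in>E. \<delta> e * (of_bool (tail e = v) - of_bool (head e = v)))
        = (\<Sum>a\<in>?C. of_bool (fst a = v) - of_bool (snd a = v))"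
      unfolding C_sum
      by (intro sum.cong) (auto simp: \<delta>_def)
    then show ?thesis using c cycle_arcs_balanced[of c v] by (simp only: directed_cycle_def)
  qed
  have "roadmap_for X E tail head f q"
    unfolding roadmap_for_iff
  proof
    fix v assume "v \<in> X"
    then have "f v = (\<Sum>e\<in>E. p e * (of_bool (tail e = v) - of_bool (head e = v)))"
      using p unfolding roadmap_for_iff by blast
    also have "\<dots> = (\<Sum>e\<in>E. p e * (of_bool (tail e = v) - of_bool (head e = v)))
               + t * (\<Sum>e\<in>E. \<delta> e * (of_bool (tail e = v) - of_bool (head e = v)))"
      by (simp only: bal mult_zero_right add_0_right)
    also have "\<dots> = (\<Sum>e\<in>E. q e * (of_bool (tail e = v) - of_bool (head e = v)))"
      unfolding sum_distrib_left sum.distrib[symmetric]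
      by (intro sum.cong) (simp_all add: q_def distrib_right mult.assoc)
    finally show "f v = (\<Sum>e\<in>E. q e * (of_bool (tail e = v) - of_bool (head e = v)))" .
  qed
  moreover have "roadmap_cost E tail head d q - roadmap_cost E tail head d p \<le> t * (\<Sum>a\<in>?C. ?w a)"
  proof -
    have edge: "\<bar>q e\<bar> * d (tail e) (head e) - \<bar>p e\<bar> * d (tail e) (head e)
        \<le> t * (of_bool ((tail e, head e) \<in> ?C) * ?w (tail e, head e)
              + of_bool ((head e, tail e) \<in> ?C) * ?w (head e, tail e))" if e: "e \<in> E" for e
    proof -
      \<comment> \<open>The rates on \<open>e\<close> per unit of length.  At most one of its two arcs is opposed, so \<open>\<sigma> \<ge> 0\<close> when
        the cycle uses both.\<close>
      define \<sigma> :: real where "\<sigma> = of_bool ((tail e, head e) \<in> ?C) * (if p e < 0 then - 1 else 1)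
              + of_bool ((head e, tail e) \<in> ?C) * (if p e > 0 then - 1 else 1)"
      have f: "t \<le> - p e" if "(tail e, head e) \<in> ?C" "p e < 0"
        using tle[of "tail e" "head e"] that e by (auto simp: T_def opposed_forward edge_ends)
      have b: "t \<le> p e" if "(head e, tail e) \<in> ?C" "p e > 0"
        using tle[of "head e" "tail e"] that e by (auto simp: T_def opposed_backward edge_ends')
      have "\<bar>q e\<bar> - \<bar>p e\<bar> \<le> t * \<sigma>"
        using f b t0 by (auto simp: q_def \<delta>_def \<sigma>_def abs_if)
      then have "(\<bar>q e\<bar> - \<bar>p e\<bar>) * d (tail e) (head e) \<le> t * \<sigma> * d (tail e) (head e)"
        using d_nonneg by (intro mult_right_mono)
      also have "\<dots> = t * (of_bool ((tail e, head e) \<in> ?C) * ?w (tail e, head e)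
              + of_bool ((head e, tail e) \<in> ?C) * ?w (head e, tail e))"
        using e by (simp add: \<sigma>_def cost_rate_forward cost_rate_backward algebra_simps)
      finally show ?thesis by (simp add: algebra_simps)
    qed
    show ?thesis
      unfolding roadmap_cost_def sum_subtractf[symmetric] C_sum sum_distrib_left
      by (intro sum_mono) (simp add: edge)
  qed
  moreover have "t * (\<Sum>a\<in>?C. ?w a) < 0" using t0 neg by (simp add: mult_pos_neg)
  ultimately show ?thesis by fastforce
qed

text \<open>
  The arcs of \<open>q - p\<close>, directed by its sign, form the support of a circulation.  Every edge
  contributes only one arc, so a cycle among these arcs cannot go back along the edge on which it
  came and has length at least three.
\<close>

lemma cheaper_roadmap_negative_cycle:
  assumes p: "roadmap_for X E tail head f p" and q: "roadmap_for X E tail head f q"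
    and less: "roadmap_cost E tail head d q < roadmap_cost E tail head d p"
  shows "\<exists>c. directed_cycle E c \<and> (\<Sum>a\<in>cycle_arcs c. cost_rate E tail head d p a) < 0"
proof (rule ccontr)
  assume no_cycle: "\<not> ?thesis"
  let ?w = "cost_rate E tail head d p"
  define r where "r e = q e - p e" for e
  let ?dir = "induced_direction tail head r"
  define D where "D = ?dir ` supp E r"
  define F where "F = (\<lambda>(u, v). \<bar>r {u, v}\<bar>)"
  have ends: "{fst (?dir e), snd (?dir e)} = e" if "e \<in> E" for e
    using that by (auto simp: induced_direction_def edge_ends edge_ends')
  have F: "F (?dir e) = \<bar>r e\<bar>" if "e \<in> E" for e
    using ends[OF that] by (simp add: F_def case_prod_unfold)
  have fin: "finite (supp E r)" using finite_E by (simp add: supp_def)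
  have inj: "inj_on ?dir (supp E r)"
    by (rule inj_onI) (metis (no_types, lifting) ends mem_Collect_eq supp_def)
  have sumD: "(\<Sum>a\<in>D. F a * h a) = (\<Sum>e\<in>E. \<bar>r e\<bar> * h (?dir e))" for h
  proof -
    have "(\<Sum>a\<in>D. F a * h a) = (\<Sum>e\<in>supp E r. \<bar>r e\<bar> * h (?dir e))"
      unfolding D_def sum.reindex[OF inj] by (intro sum.cong) (auto simp: F supp_def)
    also have "\<dots> = (\<Sum>e\<in>E. \<bar>r e\<bar> * h (?dir e))"
      using finite_E by (intro sum.mono_neutral_left) (auto simp: supp_def)
    finally show ?thesis .
  qed
  have D_edge: "{u, v} \<in> E \<and> ?dir {u, v} = (u, v) \<and> u \<noteq> v" if uv: "(u, v) \<in> D" for u v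
  proof -
    obtain e where e: "e \<in> E" "?dir e = (u, v)" using uv unfolding D_def supp_def by force
    then have "{u, v} = e" using ends[of e] by simp
    moreover have "u \<noteq> v" using e no_loop[of e] by (auto simp: induced_direction_def split: if_splits)
    ultimately show ?thesis using e by simp
  qed
  have "(\<Sum>a\<in>D. F a * ?w a) \<ge> 0"
  proof (rule circulation_weight_nonneg)
    show "finite D" using fin by (simp add: D_def)
    show "F a > 0" if "a \<in> D" for a using that F by (auto simp: D_def supp_def)
    show "(\<Sum>a\<in>D. F a * (of_bool (fst a = v) - of_bool (snd a = v))) = 0" for v
    proof -
      have "(\<Sum>a\<in>D. F a * (of_bool (fst a = v) - of_bool (snd a = v)))
          = (\<Sum>e\<in>E. r e * (of_bool (tail e = v) - of_bool (head e = v)))"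
        unfolding sumD by (intro sum.cong) (auto simp: induced_direction_def)
      also have "\<dots> = 0"
      proof (cases "v \<in> X")
        case True
        then show ?thesis
          using p q unfolding roadmap_for_iff by (simp add: r_def left_diff_distrib sum_subtractf)
      next
        case False
        then have "tail e \<noteq> v \<and> head e \<noteq> v" if "e \<in> E" for e
          using edge_ends[OF that] edges_in[OF that] by auto
        then show ?thesis by (intro sum.neutral) simp
      qed
      finally show ?thesis .
    qed
    show "(\<Sum>a\<in>cycle_arcs c. ?w a) \<ge> 0" if c: "c \<noteq> []" "distinct c" "cycle_arcs c \<subseteq> D" for c
    proof -
      have "length c \<ge> 3"
      proof (rule ccontr)
        assume "\<not> length c \<ge> 3"
        moreover have "length c \<noteq> 0" using c(1) by simp
        ultimately have "length c = 1 \<or> length c = 2" by linarith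
        then consider x where "c = [x]" | x y where "c = [x, y]"
          by (auto simp: length_Suc_conv numeral_2_eq_2)
        then show False
        proof cases
          case 1
          then have "(x, x) \<in> D" using c by (simp add: cycle_arcs_def)
          then show False using D_edge by blast
        next
          case 2
          then have "(x, y) \<in> D" "(y, x) \<in> D" using c by (simp_all add: cycle_arcs_def)
          then show False using D_edge[of x y] D_edge[of y x] by (simp add: insert_commute)
        qed
      qed
      then have "directed_cycle E c" using c D_edge by (auto simp: directed_cycle_def)
      then show ?thesis using no_cycle by force
    qed
  qed
  also have "(\<Sum>a\<in>D. F a * ?w a) \<le> roadmap_cost E tail head d q - roadmap_cost E tail head d p"
  proof -
    have "\<bar>r e\<bar> * ?w (?dir e) \<le> \<bar>q e\<bar> * d (tail e) (head e) - \<bar>p e\<bar> * d (tail e) (head e)"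
      if e: "e \<in> E" for e
    proof -
      \<comment> \<open>The slope at \<open>p e\<close> of the absolute value in the direction of \<open>r e\<close>.\<close>
      define \<sigma> :: real where "\<sigma> = (if r e > 0 then if p e < 0 then - 1 else 1
                                  else if p e > 0 then - 1 else 1)"
      have "\<bar>r e\<bar> * \<sigma> \<le> \<bar>q e\<bar> - \<bar>p e\<bar>" by (auto simp: r_def \<sigma>_def)
      then have "\<bar>r e\<bar> * \<sigma> * d (tail e) (head e) \<le> (\<bar>q e\<bar> - \<bar>p e\<bar>) * d (tail e) (head e)"
        using d_nonneg by (intro mult_right_mono)
      moreover have "?w (?dir e) = \<sigma> * d (tail e) (head e)"
        using e by (simp add: induced_direction_def \<sigma>_def cost_rate_forward cost_rate_backward)
      ultimately show ?thesis by (simp add: algebra_simps)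
    qed
    then show ?thesis
      unfolding roadmap_cost_def sum_subtractf[symmetric] sumD by (intro sum_mono)
  qed
  finally show False using less by simp
qed

end

section \<open>The optimality criterion\<close>

theorem theorem1p9:
  fixes X :: "'a set" and d :: "'a \<Rightarrow> 'a \<Rightarrow> real" and E :: "'a set set"
    and tail head :: "'a set \<Rightarrow> 'a"
    and f :: "'a \<Rightarrow> real" and p :: "'a set \<Rightarrow> real"
  assumes "Metric_space X d" and "finite X"
    and "E = canonical_edges X d"
    and "orientation E tail head"
    and "f \<in> TP X"
    and "roadmap_for X E tail head f p"
  shows "\<not> optimal_roadmap_for X E tail head d f p \<longleftrightarrow>
         (\<exists>c. directed_cycle E c \<and>
              (\<Sum>(u, v)\<in>opposed_arcs E tail head p c. d u v) >
              (\<Sum>(u, v)\<in>cycle_arcs c - opposed_arcs E tail head p c. d u v))"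
proof -
  interpret Metric_space X d by fact
  have edges_in: "e \<subseteq> X" if "e \<in> E" for e
    using that assms(3) by (auto simp: canonical_edges_def)
  have finite_E: "finite E"
    using edges_in \<open>finite X\<close> by (meson Pow_iff finite_Pow_iff finite_subset subsetI)
  have edge_ends: "{tail e, head e} = e" if "e \<in> E" for e
    using that assms(4) by (auto simp: orientation_def)
  have no_loop: "tail e \<noteq> head e" if e: "e \<in> E" for e
  proof
    assume "tail e = head e"
    then have "e = {head e}" using edge_ends[OF e] by simp
    moreover obtain u v where "e = {u, v}" "u \<noteq> v"
      using e unfolding assms(3) canonical_edges_def by blast
    ultimately show False by (metis doubleton_eq_iff insert_absorb2)
  qed
  note graph = finite_E edge_ends no_loop edges_in nonneg commute
  have "\<not> optimal_roadmap_for X E tail head d f p \<longleftrightarrow>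
        (\<exists>q. roadmap_for X E tail head f q \<and>
             roadmap_cost E tail head d q < roadmap_cost E tail head d p)"
    using assms(6) by (auto simp: optimal_roadmap_for_def not_le)
  also have "\<dots> \<longleftrightarrow> (\<exists>c. directed_cycle E c \<and>
                      (\<Sum>a\<in>cycle_arcs c. cost_rate E tail head d p a) < 0)"
    (is "?cheaper \<longleftrightarrow> ?cycle")
  proof
    assume ?cheaper
    then obtain q where q: "roadmap_for X E tail head f q"
      "roadmap_cost E tail head d q < roadmap_cost E tail head d p" by blast
    show ?cycle
      by (rule cheaper_roadmap_negative_cycle[where X = X and f = f and q = q])
        (fact graph assms(6) q)+
  next
    assume ?cycle
    then obtain c where c: "directed_cycle E c"
      "(\<Sum>a\<in>cycle_arcs c. cost_rate E tail head d p a) < 0" by blast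
    show ?cheaper
      by (rule negative_cycle_cheaper_roadmap[where X = X and c = c]) (fact graph assms(6) c)+
  qed
  finally show ?thesis unfolding sum_cost_rate_cycle by (simp only: diff_less_0_iff_less)
qed

end
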